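(* Let $S\subset\mathrm{Int}(\mathcal{C})$. Then the power flow equations $$P_i=\sum_{j\sim i}B_{ij}\exp(\rho_i+\rho_j)\sin(\theta_{ij}),\quad i\in\mathrm{pv}\cup\mathrm{pq},$$ $$\rho_i=0,\quad i\in\mathrm{pv},$$ $$Q_i=\sum_{j\sim i}B_{ij}\big(\exp(2\rho_i)-\exp(\rho_i+\rho_j)\cos(\theta_{ij})\big),\quad i\in\mathrm{pq},$$ $$\theta_s=0,\quad \rho_s=0,$$ have a solution $(\rho^*,\theta^* )\in S$ if and only if the optimization problem $$\min_{(\rho,\theta)\in\mathcal{C},\ \theta_s=0,\ \rho_s=0}E(\rho,\theta)$$ has its (unique) optimal solution in $S$.
   Context: Network: $(\mathcal{V},\mathcal{E})$ is a finite simple graph; each edge is given one arbitrary orientation, so that for an edge between $i$ and $j$ exactly one of $(i,j),(j,i)$ is in $\mathcal{E}$; write $i\sim j$ if there is an edge between $i$ and $j$. Each edge carries a real parameter $B_{ij}=B_{ji}>0$; set $B_{ij}=0$ if $i\not\sim j$. The node set is a disjoint union $\mathcal{V}=\mathrm{pv}\cup\mathrm{pq}\cup\{s\}$, where $s$ is the slack bus. $B_i=\sum_{j\sim i}B_{ij}$. Variables: real numbers $\rho_i$ (log voltage magnitudes) and $\theta_i$ (phases), with $\rho_i=0$ for $i\in\mathrm{pv}$ and $\rho_s=\theta_s=0$ fixed. The free variables are $\rho=(\rho_i)_{i\in\mathrm{pq}}$ and $\theta=(\theta_i)_{i\in\mathrm{pv}\cup\mathrm{pq}}$, and interiors ($\mathrm{Int}$)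 are taken in the space of these. Write $\rho_{ij}=\rho_i-\rho_j$, $\theta_{ij}=\theta_i-\theta_j$. Energy function: for fixed real constants $P_i$ ($i\in\mathrm{pv}\cup\mathrm{pq}$) and $Q_i$ ($i\in\mathrm{pq}$), the same constants as in the power flow equations, $$E(\rho,\theta)=-\sum_{i\in\mathrm{pv}\cup\mathrm{pq}}P_i\theta_i-\sum_{i\in\mathrm{pq}}Q_i\rho_i+\sum_{(i,j)\in\mathcal{E}}B_{ij}\frac{\exp(2\rho_i)+\exp(2\rho_j)}{2}-\sum_{(i,j)\in\mathcal{E}}B_{ij}\exp(\rho_i+\rho_j)\cos(\theta_{ij}).$$ Matrix notation: for an index set $T$, $[a]_{ii}^{T}$ is the $|T|\times|T|$ matrix (rows and columns indexed by $T$) with $(i,i)$ entry $a$ and all other entries $0$; $\left[\begin{pmatrix}a&b\\c&d\end{pmatrix}\right]_{ij}^{T}$ is the $|T|\times|T|$ matrix $M$ with $M_{ii}=a$, $M_{ij}=b$, $M_{ji}=c$, $M_{jj}=d$ and all other entries $0$. $M\succeq0$ means positive semidefinite. The set $\mathcal{C}$ consists of all $(\rho,\theta)$ such that $|\theta_i-\theta_j|\le\frac{\pi}{2}$ for all $(i,j)\in\mathcal{E}$ and $$\sum_{i\in\mathrm{pq}}\Big[\,2B_i-\sum_{j\in\mathrm{pv}\cup\{s\}}B_{ij}\frac{\exp(\rho_{ji})}{\cos(\theta_{ji})}\Big]_{ii}^{\mathrm{pq}}\;-\sum_{(i,j)\in\mathcal{E},\; i,j\in\mathrm{pq}}\frac{B_{ij}}{\cos(\theta_{ij})}\left[\begin{pmatrix}\exp(\rho_{ji})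 & 1\\ 1& \exp(\rho_{ij})\end{pmatrix}\right]_{ij}^{\mathrm{pq}}\succeq 0,$$ where the matrix inequality is understood to require $\cos(\theta_{ij})\neq0$ for every edge whose cosine appears in a denominator (edges with at least one endpoint in $\mathrm{pq}$), and is vacuous if $\mathrm{pq}=\emptyset$.
   Formalization: Uniqueness of the optimal solution is claimed only for connected networks (the equivalence itself is proved for all networks); without connectedness it fails, e.g. nodes s and 1, pv={1}, no edges, P_1=0, S={0}, where E is constant. *)

theory Defs
  imports "HOL-Analysis.Analysis"
begin

text \<open>
  The vertex set of the network is the whole finite type \<open>'n\<close>. An undirected edge is represented by
  exactly one of its two orientations in \<open>E\<close> (in particular, asymmetry excludes loops).
  A state is a pair \<open>(\<rho>, \<theta>)\<close> of vectors of log voltage magnitudes and phases.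
\<close>

type_synonym 'n state = "(real ^ 'n) \<times> (real ^ 'n)"

definition adjacent :: "('n \<times> 'n) set \<Rightarrow> 'n \<Rightarrow> 'n \<Rightarrow> bool" where
  "adjacent E i j \<longleftrightarrow> (i, j) \<in> E \<or> (j, i) \<in> E"

definition power_network ::
    "('n::finite \<times> 'n) set \<Rightarrow> ('n \<Rightarrow> 'n \<Rightarrow> real) \<Rightarrow> 'n set \<Rightarrow> 'n set \<Rightarrow> 'n \<Rightarrow> bool" where
  "power_network E B pv pq s \<longleftrightarrow>
     asym E \<and>
     (\<forall>i j. B i j = B j i) \<and>
     (\<forall>i j. adjacent E i j \<longrightarrow> B i j > 0) \<and>
     (\<forall>i j. \<not> adjacent E i j \<longrightarrow> B i j = 0) \<and>
     pv \<inter> pq = {} \<and> s \<notin> pv \<union> pq \<and> pv \<union> pq \<union> {s} = UNIV"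

definition connected_network :: "('n \<times> 'n) set \<Rightarrow> bool" where
  "connected_network E \<longleftrightarrow> (\<forall>i j. (i, j) \<in> (E \<union> E\<inverse>)\<^sup>*)"

text \<open>
  The coordinates that are not free variables are fixed to \<open>0\<close>, so this linear subspace is the space
  of the free variables \<open>\<rho>\<^sub>i\<close> (\<open>i \<in> pq\<close>) and \<open>\<theta>\<^sub>i\<close> (\<open>i \<in> pv \<union> pq\<close>).
\<close>

definition free_space :: "'n set \<Rightarrow> 'n \<Rightarrow> ('n::finite) state set" where
  "free_space pv s = {(\<rho>, \<theta>). (\<forall>i\<in>pv. \<rho> $ i = 0) \<and> \<rho> $ s = 0 \<and> \<theta> $ s = 0}"

definition energy ::
    "('n::finite \<times> 'n) set \<Rightarrow> ('n \<Rightarrow> 'n \<Rightarrow> real) \<Rightarrow> 'n set \<Rightarrow> 'n set \<Rightarrow>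
     ('n \<Rightarrow> real) \<Rightarrow> ('n \<Rightarrow> real) \<Rightarrow> 'n state \<Rightarrow> real" where
  "energy E B pv pq P Q = (\<lambda>(\<rho>, \<theta>).
     - (\<Sum>i\<in>pv \<union> pq. P i * \<theta> $ i) - (\<Sum>i\<in>pq. Q i * \<rho> $ i)
     + (\<Sum>(i, j)\<in>E. B i j * ((exp (2 * \<rho> $ i) + exp (2 * \<rho> $ j)) / 2))
     - (\<Sum>(i, j)\<in>E. B i j * exp (\<rho> $ i + \<rho> $ j) * cos (\<theta> $ i - \<theta> $ j)))"

definition power_flow ::
    "('n::finite \<times> 'n) set \<Rightarrow> ('n \<Rightarrow> 'n \<Rightarrow> real) \<Rightarrow> 'n set \<Rightarrow> 'n set \<Rightarrow> 'n \<Rightarrow>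
     ('n \<Rightarrow> real) \<Rightarrow> ('n \<Rightarrow> real) \<Rightarrow> 'n state \<Rightarrow> bool" where
  "power_flow E B pv pq s P Q = (\<lambda>(\<rho>, \<theta>).
     (\<forall>i\<in>pv \<union> pq.
        P i = (\<Sum>j | adjacent E i j. B i j * exp (\<rho> $ i + \<rho> $ j) * sin (\<theta> $ i - \<theta> $ j))) \<and>
     (\<forall>i\<in>pv. \<rho> $ i = 0) \<and>
     (\<forall>i\<in>pq.
        Q i = (\<Sum>j | adjacent E i j.
                 B i j * (exp (2 * \<rho> $ i) - exp (\<rho> $ i + \<rho> $ j) * cos (\<theta> $ i - \<theta> $ j)))) \<and>
     \<theta> $ s = 0 \<and> \<rho> $ s = 0)"

text \<open>
  A matrix with rows and columns indexed by a set \<open>T\<close> of vertices is represented by a matrix over the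
  whole vertex type; only its \<open>T \<times> T\<close> block is relevant.
\<close>

definition psd_on :: "'n set \<Rightarrow> real ^ 'n ^ ('n::finite) \<Rightarrow> bool" where
  "psd_on T M \<longleftrightarrow>
     (\<forall>k\<in>T. \<forall>l\<in>T. M $ k $ l = M $ l $ k) \<and>
     (\<forall>x :: real ^ 'n. (\<Sum>k\<in>T. \<Sum>l\<in>T. x $ k * M $ k $ l * x $ l) \<ge> 0)"

definition diag_entry :: "'n \<Rightarrow> real \<Rightarrow> real ^ 'n ^ ('n::finite)" where
  "diag_entry i a = (\<chi> k l. if k = i \<and> l = i then a else 0)"

definition block_entry ::
    "'n \<Rightarrow> 'n \<Rightarrow> real \<Rightarrow> real \<Rightarrow> real \<Rightarrow> real \<Rightarrow> real ^ 'n ^ ('n::finite)" where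
  "block_entry i j a b c d = (\<chi> k l.
     if k = i \<and> l = i then a
     else if k = i \<and> l = j then b
     else if k = j \<and> l = i then c
     else if k = j \<and> l = j then d
     else 0)"

definition region_matrix ::
    "('n::finite \<times> 'n) set \<Rightarrow> ('n \<Rightarrow> 'n \<Rightarrow> real) \<Rightarrow> 'n set \<Rightarrow> 'n set \<Rightarrow> 'n \<Rightarrow>
     'n state \<Rightarrow> real ^ 'n ^ 'n" where
  "region_matrix E B pv pq s = (\<lambda>(\<rho>, \<theta>).
     (\<Sum>i\<in>pq. diag_entry i
        (2 * (\<Sum>j | adjacent E i j. B i j)
         - (\<Sum>j\<in>pv \<union> {s}. B i j * (exp (\<rho> $ j - \<rho> $ i) / cos (\<theta> $ j - \<theta> $ i)))))
     - (\<Sum>(i, j)\<in>{(i, j) \<in> E. i \<in> pq \<and> j \<in> pq}.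
          (B i j / cos (\<theta> $ i - \<theta> $ j)) *\<^sub>R
          block_entry i j (exp (\<rho> $ j - \<rho> $ i)) 1 1 (exp (\<rho> $ i - \<rho> $ j))))"

text \<open>
  As \<open>B i j = 0\<close> for non-adjacent \<open>i, j\<close>, the cosines in the denominators of \<open>region_matrix\<close> that
  matter are those of the edges with an endpoint in \<open>pq\<close>; these are required to be nonzero.
\<close>

definition region ::
    "('n::finite \<times> 'n) set \<Rightarrow> ('n \<Rightarrow> 'n \<Rightarrow> real) \<Rightarrow> 'n set \<Rightarrow> 'n set \<Rightarrow> 'n \<Rightarrow> 'n state set" where
  "region E B pv pq s = {(\<rho>, \<theta>) \<in> free_space pv s.
     (\<forall>(i, j)\<in>E. \<bar>\<theta> $ i - \<theta> $ j\<bar> \<le> pi / 2) \<and>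
     (\<forall>(i, j)\<in>E. i \<in> pq \<or> j \<in> pq \<longrightarrow> cos (\<theta> $ i - \<theta> $ j) \<noteq> 0) \<and>
     psd_on pq (region_matrix E B pv pq s (\<rho>, \<theta>))}"

definition optimal ::
    "('n::finite \<times> 'n) set \<Rightarrow> ('n \<Rightarrow> 'n \<Rightarrow> real) \<Rightarrow> 'n set \<Rightarrow> 'n set \<Rightarrow> 'n \<Rightarrow>
     ('n \<Rightarrow> real) \<Rightarrow> ('n \<Rightarrow> real) \<Rightarrow> 'n state \<Rightarrow> bool" where
  "optimal E B pv pq s P Q =
     is_arg_min (energy E B pv pq P Q)
       (\<lambda>(\<rho>, \<theta>). (\<rho>, \<theta>) \<in> region E B pv pq s \<and> \<theta> $ s = 0 \<and> \<rho> $ s = 0)"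

end

theory Submission
  imports Defs
begin

text \<open>
  The power flow equations say that the derivative of the energy vanishes in every direction of the
  space of free variables (\<open>power_flow_iff_critical\<close>). At a point of the relative interior of the
  region, a minimizer over the region is therefore a solution. For the converse, the energy is
  convex on the region, so that a critical point is a minimizer.

  Two facts make up this convexity. First, the second derivative of the energy in a direction
  \<open>(u, v)\<close> contains, edge by edge, a quadratic polynomial in \<open>v\<^sub>i - v\<^sub>j\<close> with leading coefficient
  proportional to \<open>cos (\<theta>\<^sub>i - \<theta>\<^sub>j)\<close>. Completing the square leaves a sum of squares plus exactly the
  quadratic form of the matrix that defines the region, evaluated at \<open>z\<^sub>i = exp (\<rho>\<^sub>i) u\<^sub>i\<close>
  (\<open>energy_deriv2_eq\<close>); so the second derivative is nonnegative on the region. Second, the region is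
  convex (\<open>convex_region\<close>). The off-diagonal entries of its matrix are nonpositive, hence it suffices to
  test positive semidefiniteness on vectors \<open>z\<close> with nonnegative entries; for such a \<open>z\<close> the form is a constant
  minus nonnegative multiples of the convex functions \<open>(r, a) \<mapsto> exp r / cos a\<close>, hence concave in the
  state, and its superlevel set is convex.

  For uniqueness, let \<open>x\<close> be a minimizer in the relative interior and \<open>y\<close> any minimizer. The energy is constant on
  the segment from \<open>x\<close> to \<open>y\<close>, so its second derivative at \<open>x\<close> in the direction \<open>y - x\<close> is zero, and
  it remains to see that the second derivative at \<open>x\<close> is definite when the network is connected
  (\<open>interior_energy_deriv2_definite\<close>). Suppose the matrix form vanished at \<open>x\<close> for some \<open>z \<noteq> 0\<close>. It would
  also vanish for the vector of absolute values, where the form is concave in the state and nonnegative near \<open>x\<close>.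
  Shifting the phase of a vertex \<open>k\<close> with \<open>z\<^sub>k \<noteq> 0\<close> by \<open>\<plusminus>\<delta>\<close> decreases the form strictly on average,
  because \<open>1 / cos\<close> is strictly convex and \<open>k\<close> has a neighbour; this is a contradiction. So the \<open>\<rho>\<close>-part of
  the direction vanishes, the remaining squares force equal phase components along edges, and
  connectedness makes all of them equal to that of the slack bus, which is zero.
\<close>

section \<open>Convexity in one variable\<close>

text \<open>
  The second part is the source of uniqueness: if the minimal value is attained again at \<open>1\<close>, then \<open>f\<close> cannot
  start with positive curvature, since a derivative that becomes positive stays positive.
\<close>

lemma convex_critical_point_minimum:
  fixes f f' f'' :: "real \<Rightarrow> real"
  assumes f: "\<And>t. (f has_real_derivative f' t) (at t)"
    and f': "\<And>t. (f' has_real_derivative f'' t) (at t)"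
    and nonneg: "\<And>t. 0 \<le> t \<Longrightarrow> t \<le> 1 \<Longrightarrow> 0 \<le> f'' t"
    and crit: "f' 0 = 0"
  shows "f 0 \<le> f 1" and "f 1 \<le> f 0 \<Longrightarrow> f'' 0 = 0"
proof -
  have mono': "f' a \<le> f' b" if "0 \<le> a" "a \<le> b" "b \<le> 1" for a b
    by (rule DERIV_nonneg_imp_nondecreasing[OF \<open>a \<le> b\<close>]) (use that f' nonneg in force)
  have mono: "f a \<le> f b" if "0 \<le> a" "a \<le> b" "b \<le> 1" for a b
  proof (rule DERIV_nonneg_imp_nondecreasing[OF \<open>a \<le> b\<close>])
    fix t assume "a \<le> t" "t \<le> b"
    then have "0 \<le> f' t" using mono'[of 0 t] that crit by auto
    then show "\<exists>y. DERIV f t :> y \<and> 0 \<le> y" using f by blast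
  qed
  show "f 0 \<le> f 1" using mono[of 0 1] by simp
  show "f'' 0 = 0" if le: "f 1 \<le> f 0"
  proof (rule ccontr)
    assume "f'' 0 \<noteq> 0"
    then have "0 < f'' 0" using nonneg[of 0] by simp
    from DERIV_pos_inc_right[OF f' this] obtain d where d: "0 < d"
      "\<And>h. 0 < h \<Longrightarrow> h < d \<Longrightarrow> f' 0 < f' (0 + h)" by blast
    define h where "h = min (d / 2) (1 / 2)"
    have h: "0 < h" "h < d" "h < 1" using d(1) by (auto simp: h_def)
    have "0 < f' h" using d(2)[of h] h crit by simp
    obtain z where z: "h < z" "z < 1" "f 1 - f h = (1 - h) * f' z"
      using MVT2[of h 1 f f'] f h by blast
    have "0 < f' z" using mono'[of h z] \<open>0 < f' h\<close> z h by simp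
    then have "f h < f 1" using z(3) h by (smt (verit) mult_pos_pos)
    then show False using mono[of 0 h] h le by simp
  qed
qed

lemma neg_ln_cos_convex: "convex_on {-(pi/2)<..<pi/2} (\<lambda>a::real. - ln (cos a))"
proof (rule f''_ge0_imp_convex[where f' = tan and f'' = "\<lambda>a. inverse ((cos a)\<^sup>2)"])
  fix a :: real assume "a \<in> {-(pi/2)<..<pi/2}"
  then have c: "0 < cos a" by (auto intro: cos_gt_zero_pi)
  then show "((\<lambda>a. - ln (cos a)) has_real_derivative tan a) (at a)"
    by (auto intro!: derivative_eq_intros simp: tan_def field_simps)
  show "(tan has_real_derivative inverse ((cos a)\<^sup>2)) (at a)"
    using c by (intro DERIV_tan) simp
qed auto

lemma cos_nonzero_iff:
  fixes a :: real assumes "\<bar>a\<bar> \<le> pi / 2" shows "cos a \<noteq> 0 \<longleftrightarrow> \<bar>a\<bar> < pi / 2"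
proof
  assume "cos a \<noteq> 0"
  then have 1: "a \<noteq> pi / 2" by (metis cos_pi_half)
  have 2: "a \<noteq> - (pi / 2)" using \<open>cos a \<noteq> 0\<close> by (metis cos_minus cos_pi_half)
  show "\<bar>a\<bar> < pi / 2" using 1 2 assms by linarith
next
  assume "\<bar>a\<bar> < pi / 2"
  then show "cos a \<noteq> 0" using cos_gt_zero_pi[of a] by linarith
qed

text \<open>
  The function is \<open>exp\<close> of the convex function \<open>r - ln (cos a)\<close>, and \<open>exp\<close> is convex and increasing.
\<close>

lemma exp_div_cos_convex:
  fixes a b r q t :: real
  assumes "\<bar>a\<bar> < pi / 2" "\<bar>b\<bar> < pi / 2" "0 \<le> t" "t \<le> 1"
  shows "exp ((1 - t) * r + t * q) / cos ((1 - t) * a + t * b)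
    \<le> (1 - t) * (exp r / cos a) + t * (exp q / cos b)"
proof -
  let ?I = "{-(pi/2)<..<pi/2}" and ?c = "(1 - t) * a + t * b"
  have ab: "a \<in> ?I" "b \<in> ?I" using assms by auto
  then have c: "?c \<in> ?I"
    using convexD_alt[OF convex_real_interval(8), of a "-(pi/2)" "pi/2" b t] assms by auto
  have e: "exp x / cos y = exp (x - ln (cos y))" if "y \<in> ?I" for x y
    using that cos_gt_zero_pi[of y] by (simp add: exp_diff)
  have "exp ((1 - t) * r + t * q) / cos ?c = exp ((1 - t) * r + t * q - ln (cos ?c))"
    by (rule e[OF c])
  also have "\<dots> \<le> exp ((1 - t) * (r - ln (cos a)) + t * (q - ln (cos b)))"
    using convex_onD[OF neg_ln_cos_convex, of t a b] ab assms by (simp add: algebra_simps)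
  also have "\<dots> \<le> (1 - t) * exp (r - ln (cos a)) + t * exp (q - ln (cos b))"
    using convex_onD[OF exp_convex, of t "r - ln (cos a)" "q - ln (cos b)"] assms by simp
  also have "\<dots> = (1 - t) * (exp r / cos a) + t * (exp q / cos b)"
    by (simp only: e[OF ab(1)] e[OF ab(2)])
  finally show ?thesis .
qed

text \<open>
  The arithmetic mean of the two reciprocals is at least the reciprocal of the mean of the cosines,
  and that mean is \<open>cos a * cos d < cos a\<close>.
\<close>

lemma inverse_cos_strict_midpoint:
  fixes a d :: real
  assumes "0 < cos (a + d)" "0 < cos (a - d)" "0 < cos a" "0 < d" "d < pi"
  shows "2 / cos a < 1 / cos (a + d) + 1 / cos (a - d)"
proof -
  let ?p = "cos (a + d)" and ?q = "cos (a - d)"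
  have "cos d < 1" using cos_monotone_0_pi[of 0 d] assms by simp
  have "?p + ?q = 2 * cos a * cos d" by (simp add: cos_add cos_diff)
  then have less: "?p + ?q < 2 * cos a" using \<open>cos d < 1\<close> assms by simp
  have "4 * (?p * ?q) \<le> (?p + ?q)\<^sup>2"
    using zero_le_power2[of "?p - ?q"] by (simp only: power2_eq_square algebra_simps)
  then have "4 / (?p + ?q) \<le> 1 / ?p + 1 / ?q"
    using assms by (simp add: field_simps power2_eq_square)
  moreover have "2 / cos a < 4 / (?p + ?q)"
    using less assms by (simp add: field_simps)
  ultimately show ?thesis by simp
qed

section \<open>The quadratic form of the region\<close>

text \<open>
  For a vector \<open>z\<close> that vanishes outside \<open>pq\<close>, each edge between two vertices of \<open>pq\<close>, or between
  \<open>pq\<close> and its complement, contributes the same expression to the quadratic form of \<open>region_matrix\<close>. The two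
  kinds of terms of that matrix thereby merge into one sum over all edges.
\<close>

definition edge_form :: "real ^ 'n \<Rightarrow> real ^ 'n \<Rightarrow> real ^ 'n \<Rightarrow> 'n \<Rightarrow> 'n \<Rightarrow> real" where
  "edge_form \<rho> \<theta> z i j = 2 * (z $ i)\<^sup>2 + 2 * (z $ j)\<^sup>2
     - (exp (\<rho> $ j - \<rho> $ i) * (z $ i)\<^sup>2 + 2 * (z $ i) * (z $ j) + exp (\<rho> $ i - \<rho> $ j) * (z $ j)\<^sup>2)
       / cos (\<theta> $ i - \<theta> $ j)"

definition network_form ::
    "('n::finite \<times> 'n) set \<Rightarrow> ('n \<Rightarrow> 'n \<Rightarrow> real) \<Rightarrow> real ^ 'n \<Rightarrow> real ^ 'n \<Rightarrow> real ^ 'n \<Rightarrow> real" where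
  "network_form E B \<rho> \<theta> z = (\<Sum>(i, j)\<in>E. B i j * edge_form \<rho> \<theta> z i j)"

definition quad_on :: "'n set \<Rightarrow> real ^ 'n \<Rightarrow> real ^ 'n ^ ('n::finite) \<Rightarrow> real" where
  "quad_on T z M = (\<Sum>k\<in>T. \<Sum>l\<in>T. z $ k * M $ k $ l * z $ l)"

lemma quad_on_diff: "quad_on T z (M - N) = quad_on T z M - quad_on T z N"
  by (simp add: quad_on_def algebra_simps sum_subtractf)

lemma quad_on_scaleR: "quad_on T z (c *\<^sub>R M) = c * quad_on T z M"
  by (simp add: quad_on_def algebra_simps sum_distrib_left)

lemma quad_on_sum: "quad_on T z (\<Sum>a\<in>A. M a) = (\<Sum>a\<in>A. quad_on T z (M a))"
proof (induction A rule: infinite_finite_induct)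
  case (insert a A)
  then show ?case
    by (simp add: quad_on_def algebra_simps sum.distrib)
qed (auto simp: quad_on_def)

lemma quad_on_diag_entry:
  assumes "i \<in> T" shows "quad_on T z (diag_entry i a) = a * (z $ i)\<^sup>2"
proof -
  have "quad_on T z (diag_entry i a)
      = (\<Sum>k\<in>T. \<Sum>l\<in>T. if k = i then if l = i then a * (z $ i)\<^sup>2 else 0 else 0)"
    unfolding quad_on_def diag_entry_def
    by (intro sum.cong refl) (auto simp: power2_eq_square)
  also have "\<dots> = a * (z $ i)\<^sup>2"
    using assms by (subst sum.swap) simp
  finally show ?thesis .
qed

lemma quad_on_block_entry:
  assumes "i \<in> T" "j \<in> T" "i \<noteq> j"
  shows "quad_on T z (block_entry i j a b c d)
    = a * (z $ i)\<^sup>2 + (b + c) * (z $ i) * (z $ j) + d * (z $ j)\<^sup>2"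
proof -
  let ?row = "\<lambda>p q. (\<Sum>l\<in>T. (if l = i then p else 0) + (if l = j then q else 0))"
  have "quad_on T z (block_entry i j a b c d)
      = (\<Sum>k\<in>T. (if k = i then ?row (a * (z $ i)\<^sup>2) (b * z $ i * z $ j) else 0)
             + (if k = j then ?row (c * z $ i * z $ j) (d * (z $ j)\<^sup>2) else 0))"
    unfolding quad_on_def block_entry_def using \<open>i \<noteq> j\<close>
    by (intro sum.cong refl) (auto intro!: sum.cong simp: power2_eq_square)
  then show ?thesis using assms by (simp add: sum.distrib algebra_simps)
qed

locale network =
  fixes E :: "('n::finite \<times> 'n) set" and B :: "'n \<Rightarrow> 'n \<Rightarrow> real" and pv pq :: "'n set" and s :: 'n
  assumes power_network: "power_network E B pv pq s"
begin

lemma edge_neq: "(i, j) \<in> E \<Longrightarrow> i \<noteq> j"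
  using power_network by (auto simp: power_network_def asym_on_def asymp_on_def dest: asymD)

lemma B_sym: "B i j = B j i"
  using power_network by (auto simp: power_network_def)

lemma B_pos: "(i, j) \<in> E \<Longrightarrow> 0 < B i j"
  using power_network by (auto simp: power_network_def adjacent_def)

lemma B_nonadjacent: "\<not> adjacent E i j \<Longrightarrow> B i j = 0"
  using power_network by (auto simp: power_network_def)

lemma not_in_pq_iff: "i \<notin> pq \<longleftrightarrow> i \<in> pv \<union> {s}"
  using power_network by (auto simp: power_network_def)

lemma pv_pq_eq: "pv \<union> pq = - {s}"
  using power_network by (auto simp: power_network_def)

lemma sum_adjacent_eq_sum_edges:
  fixes F :: "'n \<Rightarrow> 'n \<Rightarrow> real"
  shows "(\<Sum>i\<in>UNIV. \<Sum>j | adjacent E i j. F i j) = (\<Sum>(i, j)\<in>E. F i j + F j i)"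
proof -
  have "(\<Sum>i\<in>UNIV. \<Sum>j | adjacent E i j. F i j) = (\<Sum>(i, j)\<in>E \<union> E\<inverse>. F i j)"
    by (subst sum.Sigma) (auto intro!: sum.cong simp: adjacent_def)
  also have "\<dots> = (\<Sum>(i, j)\<in>E. F i j) + (\<Sum>(i, j)\<in>E\<inverse>. F i j)"
    using power_network by (intro sum.union_disjoint) (auto simp: power_network_def dest: asymD)
  also have "(\<Sum>(i, j)\<in>E\<inverse>. F i j) = (\<Sum>(i, j)\<in>E. F j i)"
    by (rule sum.reindex_bij_witness[where i = prod.swap and j = prod.swap]) auto
  finally show ?thesis by (simp add: sum.distrib case_prod_unfold)
qed

text \<open>
  Both diagonal sums become sums over edges, since each edge is counted once from either end. On an edge leaving \<open>pq\<close>
  only the diagonal contribution of its end in \<open>pq\<close> survives, and on an edge outside \<open>pq\<close> nothing does,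
  in agreement with \<open>edge_form\<close> because \<open>z\<close> is zero there.
\<close>

lemma quad_on_region_matrix:
  assumes z: "\<And>i. i \<notin> pq \<Longrightarrow> z $ i = 0"
  shows "quad_on pq z (region_matrix E B pv pq s (\<rho>, \<theta>)) = network_form E B \<rho> \<theta> z"
proof -
  let ?g = "\<lambda>i j. exp (\<rho> $ j - \<rho> $ i) / cos (\<theta> $ j - \<theta> $ i)"
  let ?h = "\<lambda>i j. (B i j / cos (\<theta> $ i - \<theta> $ j)) * (exp (\<rho> $ j - \<rho> $ i) * (z $ i)\<^sup>2
        + 2 * z $ i * z $ j + exp (\<rho> $ i - \<rho> $ j) * (z $ j)\<^sup>2)"
  let ?F = "\<lambda>i j. 2 * B i j * (z $ i)\<^sup>2 - (if j \<notin> pq then B i j * ?g i j * (z $ i)\<^sup>2 else 0)"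
  have row: "(2 * (\<Sum>j | adjacent E i j. B i j) - (\<Sum>j\<in>pv \<union> {s}. B i j * ?g i j)) * (z $ i)\<^sup>2
      = (\<Sum>j | adjacent E i j. ?F i j)" for i
  proof -
    have "(\<Sum>j\<in>pv \<union> {s}. B i j * ?g i j) = (\<Sum>j\<in>UNIV. if j \<notin> pq then B i j * ?g i j else 0)"
      by (subst sum.inter_filter[symmetric]) (auto intro!: sum.cong simp: not_in_pq_iff)
    also have "\<dots> = (\<Sum>j | adjacent E i j. if j \<notin> pq then B i j * ?g i j else 0)"
      by (rule sum.mono_neutral_right) (auto simp: B_nonadjacent)
    finally show ?thesis
      by (auto simp: sum_subtractf sum_distrib_left sum_distrib_right left_diff_distrib intro!: sum.cong)
  qed
  have "quad_on pq z (region_matrix E B pv pq s (\<rho>, \<theta>))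
      = (\<Sum>i\<in>pq. \<Sum>j | adjacent E i j. ?F i j) - (\<Sum>(i, j)\<in>{(i, j) \<in> E. i \<in> pq \<and> j \<in> pq}. ?h i j)"
    unfolding region_matrix_def case_prod_conv quad_on_diff quad_on_sum
  proof (intro arg_cong2[where f = "(-)"] sum.cong refl)
    fix i assume "i \<in> pq"
    then show "quad_on pq z (diag_entry i (2 * (\<Sum>j | adjacent E i j. B i j)
        - (\<Sum>j\<in>pv \<union> {s}. B i j * ?g i j))) = (\<Sum>j | adjacent E i j. ?F i j)"
      by (simp only: quad_on_diag_entry row)
  next
    fix e assume "e \<in> {(i, j) \<in> E. i \<in> pq \<and> j \<in> pq}"
    then show "quad_on pq z (case e of (i, j) \<Rightarrow> (B i j / cos (\<theta> $ i - \<theta> $ j)) *\<^sub>R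
        block_entry i j (exp (\<rho> $ j - \<rho> $ i)) 1 1 (exp (\<rho> $ i - \<rho> $ j))) = (case e of (i, j) \<Rightarrow> ?h i j)"
      using edge_neq by (auto simp: quad_on_scaleR quad_on_block_entry)
  qed
  also have "(\<Sum>i\<in>pq. \<Sum>j | adjacent E i j. ?F i j) = (\<Sum>i\<in>UNIV. \<Sum>j | adjacent E i j. ?F i j)"
    by (rule sum.mono_neutral_left) (auto simp: z intro!: sum.neutral)
  also have "\<dots> = (\<Sum>(i, j)\<in>E. ?F i j + ?F j i)"
    by (rule sum_adjacent_eq_sum_edges)
  also have "(\<Sum>(i, j)\<in>{(i, j) \<in> E. i \<in> pq \<and> j \<in> pq}. ?h i j)
      = (\<Sum>(i, j)\<in>E. if i \<in> pq \<and> j \<in> pq then ?h i j else 0)"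
    by (rule sum.mono_neutral_cong_left) (auto split: if_splits)
  also have "(\<Sum>(i, j)\<in>E. ?F i j + ?F j i) - \<dots> = network_form E B \<rho> \<theta> z"
    unfolding network_form_def sum_subtractf[symmetric]
  proof (intro sum.cong refl, clarify)
    fix i j
    have c: "cos (\<theta> $ j - \<theta> $ i) = cos (\<theta> $ i - \<theta> $ j)" by (metis cos_minus minus_diff_eq)
    show "?F i j + ?F j i - (if i \<in> pq \<and> j \<in> pq then ?h i j else 0) = B i j * edge_form \<rho> \<theta> z i j"
      unfolding edge_form_def c B_sym[of j i]
      by (cases "i \<in> pq"; cases "j \<in> pq")
        (simp_all add: z ring_distribs add_divide_distrib)
  qed
  finally show ?thesis .
qed

lemma region_matrix_sym: "region_matrix E B pv pq s x $ k $ l = region_matrix E B pv pq s x $ l $ k"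
proof -
  have "diag_entry i a $ k $ l = diag_entry i a $ l $ k" for i a
    by (simp add: diag_entry_def)
  moreover have "block_entry i j a b b c $ k $ l = block_entry i j a b b c $ l $ k" for i j a b c
    by (cases "k = i"; cases "k = j"; cases "l = i"; cases "l = j") (simp_all add: block_entry_def)
  ultimately show ?thesis
    by (simp only: region_matrix_def case_prod_unfold sum_component vector_minus_component
        vector_scaleR_component)
qed

lemma psd_region_matrix_iff:
  "psd_on pq (region_matrix E B pv pq s (\<rho>, \<theta>))
    \<longleftrightarrow> (\<forall>z. (\<forall>i. i \<notin> pq \<longrightarrow> z $ i = 0) \<longrightarrow> 0 \<le> network_form E B \<rho> \<theta> z)"
proof -
  let ?M = "region_matrix E B pv pq s (\<rho>, \<theta>)"
  have "psd_on pq ?M \<longleftrightarrow> (\<forall>z. 0 \<le> quad_on pq z ?M)"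
    using region_matrix_sym by (auto simp: psd_on_def quad_on_def)
  also have "\<dots> \<longleftrightarrow> (\<forall>z. (\<forall>i. i \<notin> pq \<longrightarrow> z $ i = 0) \<longrightarrow> 0 \<le> quad_on pq z ?M)"
  proof (intro iffI allI)
    fix z assume *: "\<forall>z. (\<forall>i. i \<notin> pq \<longrightarrow> z $ i = 0) \<longrightarrow> 0 \<le> quad_on pq z ?M"
    have "quad_on pq z ?M = quad_on pq (\<chi> i. if i \<in> pq then z $ i else 0) ?M"
      unfolding quad_on_def by (intro sum.cong) auto
    then show "0 \<le> quad_on pq z ?M" using * by simp
  qed auto
  also have "\<dots> \<longleftrightarrow> (\<forall>z. (\<forall>i. i \<notin> pq \<longrightarrow> z $ i = 0) \<longrightarrow> 0 \<le> network_form E B \<rho> \<theta> z)"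
    by (intro all_cong1 imp_cong refl) (simp add: quad_on_region_matrix)
  finally show ?thesis .
qed

lemma regionD:
  assumes "(\<rho>, \<theta>) \<in> region E B pv pq s"
  shows "(\<rho>, \<theta>) \<in> free_space pv s"
    and "\<And>i j. (i, j) \<in> E \<Longrightarrow> \<bar>\<theta> $ i - \<theta> $ j\<bar> \<le> pi / 2"
    and "\<And>i j. (i, j) \<in> E \<Longrightarrow> i \<in> pq \<or> j \<in> pq \<Longrightarrow> \<bar>\<theta> $ i - \<theta> $ j\<bar> < pi / 2"
    and "\<And>z. (\<And>i. i \<notin> pq \<Longrightarrow> z $ i = 0) \<Longrightarrow> 0 \<le> network_form E B \<rho> \<theta> z"
proof -
  have free: "(\<rho>, \<theta>) \<in> free_space pv s"
    and le: "\<forall>(i, j)\<in>E. \<bar>\<theta> $ i - \<theta> $ j\<bar> \<le> pi / 2"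
    and ne: "\<forall>(i, j)\<in>E. i \<in> pq \<or> j \<in> pq \<longrightarrow> cos (\<theta> $ i - \<theta> $ j) \<noteq> 0"
    and psd: "psd_on pq (region_matrix E B pv pq s (\<rho>, \<theta>))"
    using assms by (simp_all add: region_def)
  show "(\<rho>, \<theta>) \<in> free_space pv s" by (rule free)
  show le': "\<bar>\<theta> $ i - \<theta> $ j\<bar> \<le> pi / 2" if "(i, j) \<in> E" for i j
    using bspec[OF le that] by simp
  show "\<bar>\<theta> $ i - \<theta> $ j\<bar> < pi / 2" if "(i, j) \<in> E" "i \<in> pq \<or> j \<in> pq" for i j
    using bspec[OF ne that(1), unfolded case_prod_conv] that(2) cos_nonzero_iff[OF le'[OF that(1)]] by blast
  show "0 \<le> network_form E B \<rho> \<theta> z" if "\<And>i. i \<notin> pq \<Longrightarrow> z $ i = 0" for z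
    by (rule psd[unfolded psd_region_matrix_iff, rule_format]) (rule that)
qed

lemma regionI:
  assumes "(\<rho>, \<theta>) \<in> free_space pv s"
    and "\<And>i j. (i, j) \<in> E \<Longrightarrow> \<bar>\<theta> $ i - \<theta> $ j\<bar> \<le> pi / 2"
    and "\<And>i j. (i, j) \<in> E \<Longrightarrow> i \<in> pq \<or> j \<in> pq \<Longrightarrow> \<bar>\<theta> $ i - \<theta> $ j\<bar> < pi / 2"
    and "\<And>z. (\<And>i. i \<notin> pq \<Longrightarrow> z $ i = 0) \<Longrightarrow> 0 \<le> network_form E B \<rho> \<theta> z"
  shows "(\<rho>, \<theta>) \<in> region E B pv pq s"
proof -
  have "\<forall>(i, j)\<in>E. \<bar>\<theta> $ i - \<theta> $ j\<bar> \<le> pi / 2"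
    using assms(2) by (intro ballI case_prodI2) simp
  moreover have "\<forall>(i, j)\<in>E. i \<in> pq \<or> j \<in> pq \<longrightarrow> cos (\<theta> $ i - \<theta> $ j) \<noteq> 0"
    using assms(3) cos_nonzero_iff[OF assms(2)] by (intro ballI case_prodI2) blast
  moreover have "psd_on pq (region_matrix E B pv pq s (\<rho>, \<theta>))"
    unfolding psd_region_matrix_iff by (intro allI impI assms(4)) blast
  ultimately show ?thesis
    using assms(1) by (simp add: region_def)
qed

lemma region_cos_nonneg:
  assumes "(\<rho>, \<theta>) \<in> region E B pv pq s" "(i, j) \<in> E"
  shows "0 \<le> cos (\<theta> $ i - \<theta> $ j)"
    and "i \<in> pq \<or> j \<in> pq \<Longrightarrow> 0 < cos (\<theta> $ i - \<theta> $ j)"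
proof -
  show "0 \<le> cos (\<theta> $ i - \<theta> $ j)"
    using regionD(2)[OF assms] by (intro cos_ge_zero) linarith+
  show "0 < cos (\<theta> $ i - \<theta> $ j)" if "i \<in> pq \<or> j \<in> pq"
    using regionD(3)[OF assms that] by (intro cos_gt_zero_pi) linarith+
qed

text \<open>
  Only the mixed terms \<open>z\<^sub>i z\<^sub>j\<close> see the signs, and they enter with a nonpositive coefficient.
\<close>

lemma network_form_abs_le:
  assumes c: "\<And>i j. (i, j) \<in> E \<Longrightarrow> 0 \<le> cos (\<theta> $ i - \<theta> $ j)"
  shows "network_form E B \<rho> \<theta> (\<chi> i. \<bar>z $ i\<bar>) \<le> network_form E B \<rho> \<theta> z"
  unfolding network_form_def
proof (rule sum_mono, clarify)
  fix i j assume ij: "(i, j) \<in> E"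
  have "z $ i * z $ j \<le> \<bar>z $ i\<bar> * \<bar>z $ j\<bar>" by (metis abs_ge_self abs_mult)
  then have "exp (\<rho> $ j - \<rho> $ i) * (z $ i)\<^sup>2 + 2 * z $ i * z $ j + exp (\<rho> $ i - \<rho> $ j) * (z $ j)\<^sup>2
      \<le> exp (\<rho> $ j - \<rho> $ i) * (z $ i)\<^sup>2 + 2 * \<bar>z $ i\<bar> * \<bar>z $ j\<bar> + exp (\<rho> $ i - \<rho> $ j) * (z $ j)\<^sup>2"
    by simp
  from divide_right_mono[OF this c[OF ij]]
  have "edge_form \<rho> \<theta> (\<chi> i. \<bar>z $ i\<bar>) i j \<le> edge_form \<rho> \<theta> z i j"
    by (simp add: edge_form_def)
  then show "B i j * edge_form \<rho> \<theta> (\<chi> i. \<bar>z $ i\<bar>) i j \<le> B i j * edge_form \<rho> \<theta> z i j"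
    using B_pos[OF ij] by simp
qed

text \<open>
  The signs of \<open>z\<close> matter here: the term \<open>2 z\<^sub>i z\<^sub>j / cos (\<theta>\<^sub>i - \<theta>\<^sub>j)\<close> is convex in the phases only
  for \<open>z\<^sub>i z\<^sub>j \<ge> 0\<close>.
\<close>

lemma edge_form_concave:
  assumes "\<bar>\<theta> $ i - \<theta> $ j\<bar> < pi / 2" "\<bar>\<theta>' $ i - \<theta>' $ j\<bar> < pi / 2" "0 \<le> t" "t \<le> 1"
    and z: "0 \<le> z $ i" "0 \<le> z $ j"
  shows "(1 - t) * edge_form \<rho> \<theta> z i j + t * edge_form \<rho>' \<theta>' z i j
    \<le> edge_form ((1 - t) *\<^sub>R \<rho> + t *\<^sub>R \<rho>') ((1 - t) *\<^sub>R \<theta> + t *\<^sub>R \<theta>') z i j"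
proof -
  let ?\<rho> = "(1 - t) *\<^sub>R \<rho> + t *\<^sub>R \<rho>'" and ?\<theta> = "(1 - t) *\<^sub>R \<theta> + t *\<^sub>R \<theta>'"
  have \<theta>: "?\<theta> $ i - ?\<theta> $ j = (1 - t) * (\<theta> $ i - \<theta> $ j) + t * (\<theta>' $ i - \<theta>' $ j)"
    by (simp add: algebra_simps)
  have e: "edge_form \<rho> \<theta> z i j = 2 * (z $ i)\<^sup>2 + 2 * (z $ j)\<^sup>2
      - ((z $ i)\<^sup>2 * (exp (\<rho> $ j - \<rho> $ i) / cos (\<theta> $ i - \<theta> $ j))
        + 2 * (z $ i) * (z $ j) * (exp 0 / cos (\<theta> $ i - \<theta> $ j))
        + (z $ j)\<^sup>2 * (exp (\<rho> $ i - \<rho> $ j) / cos (\<theta> $ i - \<theta> $ j)))" for \<rho> \<theta>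
    by (simp add: edge_form_def add_divide_distrib algebra_simps)
  note cvx = exp_div_cos_convex[OF assms(1-4)]
  have "exp (?\<rho> $ j - ?\<rho> $ i) / cos (?\<theta> $ i - ?\<theta> $ j)
      \<le> (1 - t) * (exp (\<rho> $ j - \<rho> $ i) / cos (\<theta> $ i - \<theta> $ j))
        + t * (exp (\<rho>' $ j - \<rho>' $ i) / cos (\<theta>' $ i - \<theta>' $ j))"
    using cvx[of "\<rho> $ j - \<rho> $ i" "\<rho>' $ j - \<rho>' $ i"] unfolding \<theta> by (simp add: algebra_simps)
  note 1 = mult_left_mono[OF this, of "(z $ i)\<^sup>2"]
  have "exp 0 / cos (?\<theta> $ i - ?\<theta> $ j)
      \<le> (1 - t) * (exp 0 / cos (\<theta> $ i - \<theta> $ j)) + t * (exp 0 / cos (\<theta>' $ i - \<theta>' $ j))"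
    using cvx[of 0 0] unfolding \<theta> by simp
  note 2 = mult_left_mono[OF this, of "2 * (z $ i) * (z $ j)"]
  have "exp (?\<rho> $ i - ?\<rho> $ j) / cos (?\<theta> $ i - ?\<theta> $ j)
      \<le> (1 - t) * (exp (\<rho> $ i - \<rho> $ j) / cos (\<theta> $ i - \<theta> $ j))
        + t * (exp (\<rho>' $ i - \<rho>' $ j) / cos (\<theta>' $ i - \<theta>' $ j))"
    using cvx[of "\<rho> $ i - \<rho> $ j" "\<rho>' $ i - \<rho>' $ j"] unfolding \<theta> by (simp add: algebra_simps)
  note 3 = mult_left_mono[OF this, of "(z $ j)\<^sup>2"]
  show ?thesis
    unfolding e using 1 2 3 z by (simp add: algebra_simps)
qed

lemma subspace_free_space: "subspace (free_space pv s)"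
  by (auto simp: subspace_def free_space_def zero_prod_def)

lemma convex_region: "convex (region E B pv pq s)"
  unfolding convex_alt
proof (intro ballI allI impI)
  fix x y :: "(real ^ 'n) \<times> (real ^ 'n)" and t :: real
  assume xR: "x \<in> region E B pv pq s" and yR: "y \<in> region E B pv pq s" and t: "0 \<le> t \<and> t \<le> 1"
  obtain \<rho> \<theta> \<rho>' \<theta>' where xy: "x = (\<rho>, \<theta>)" "y = (\<rho>', \<theta>')" by (metis surj_pair)
  let ?\<rho> = "(1 - t) *\<^sub>R \<rho> + t *\<^sub>R \<rho>'" and ?\<theta> = "(1 - t) *\<^sub>R \<theta> + t *\<^sub>R \<theta>'"
  note x = regionD[OF xR[unfolded xy]] and y = regionD[OF yR[unfolded xy]]
  have diff: "?\<theta> $ i - ?\<theta> $ j = (1 - t) * (\<theta> $ i - \<theta> $ j) + t * (\<theta>' $ i - \<theta>' $ j)" for i j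
    by (simp add: algebra_simps)
  have le: "\<bar>?\<theta> $ i - ?\<theta> $ j\<bar> \<le> pi / 2" if "(i, j) \<in> E" for i j
  proof -
    have "\<theta> $ i - \<theta> $ j \<in> {-(pi/2)..pi/2}" "\<theta>' $ i - \<theta>' $ j \<in> {-(pi/2)..pi/2}"
      unfolding atLeastAtMost_iff using x(2)[OF that] y(2)[OF that] by linarith+
    from convexD_alt[OF convex_real_interval(5) this, of t] show ?thesis
      unfolding diff real_scaleR_def atLeastAtMost_iff using t by linarith
  qed
  have less: "\<bar>?\<theta> $ i - ?\<theta> $ j\<bar> < pi / 2" if "(i, j) \<in> E" "i \<in> pq \<or> j \<in> pq" for i j
  proof -
    have "\<theta> $ i - \<theta> $ j \<in> {-(pi/2)<..<pi/2}" "\<theta>' $ i - \<theta>' $ j \<in> {-(pi/2)<..<pi/2}"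
      unfolding greaterThanLessThan_iff using x(3)[OF that] y(3)[OF that] by linarith+
    from convexD_alt[OF convex_real_interval(8) this, of t] show ?thesis
      unfolding diff real_scaleR_def greaterThanLessThan_iff using t by linarith
  qed
  have free: "(?\<rho>, ?\<theta>) \<in> free_space pv s"
    using x(1) y(1) by (simp add: free_space_def)
  have nonneg: "0 \<le> network_form E B ?\<rho> ?\<theta> z" if z: "\<And>i. i \<notin> pq \<Longrightarrow> z $ i = 0" "\<And>i. 0 \<le> z $ i" for z
  proof -
    have "0 \<le> (1 - t) * network_form E B \<rho> \<theta> z + t * network_form E B \<rho>' \<theta>' z"
      using x(4)[OF z(1)] y(4)[OF z(1)] t by simp
    also have "\<dots> = (\<Sum>(i, j)\<in>E. B i j * ((1 - t) * edge_form \<rho> \<theta> z i j + t * edge_form \<rho>' \<theta>' z i j))"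
      by (simp add: network_form_def sum_distrib_left case_prod_unfold sum.distrib[symmetric] algebra_simps)
    also have "\<dots> \<le> network_form E B ?\<rho> ?\<theta> z"
      unfolding network_form_def
    proof (rule sum_mono, clarify)
      fix i j assume ij: "(i, j) \<in> E"
      have "(1 - t) * edge_form \<rho> \<theta> z i j + t * edge_form \<rho>' \<theta>' z i j \<le> edge_form ?\<rho> ?\<theta> z i j"
      proof (cases "i \<in> pq \<or> j \<in> pq")
        case True
        then show ?thesis using x(3)[OF ij] y(3)[OF ij] t z(2) by (intro edge_form_concave) auto
      next
        case False
        then show ?thesis by (simp add: edge_form_def z)
      qed
      then show "B i j * ((1 - t) * edge_form \<rho> \<theta> z i j + t * edge_form \<rho>' \<theta>' z i j)
          \<le> B i j * edge_form ?\<rho> ?\<theta> z i j"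
        using B_pos[OF ij] by simp
    qed
    finally show ?thesis .
  qed
  \<comment> \<open>Passing to absolute values reduces an arbitrary vector to the case of concavity.\<close>
  have "0 \<le> network_form E B ?\<rho> ?\<theta> z" if z: "\<forall>i. i \<notin> pq \<longrightarrow> z $ i = 0" for z
  proof -
    have "network_form E B ?\<rho> ?\<theta> (\<chi> i. \<bar>z $ i\<bar>) \<le> network_form E B ?\<rho> ?\<theta> z"
    proof (rule network_form_abs_le)
      fix i j assume "(i, j) \<in> E"
      from le[OF this] show "0 \<le> cos (?\<theta> $ i - ?\<theta> $ j)" by (intro cos_ge_zero) linarith+
    qed
    moreover have "0 \<le> network_form E B ?\<rho> ?\<theta> (\<chi> i. \<bar>z $ i\<bar>)"
      using z by (intro nonneg) auto
    ultimately show ?thesis by simp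
  qed
  then show "(1 - t) *\<^sub>R x + t *\<^sub>R y \<in> region E B pv pq s"
    unfolding xy scaleR_Pair add_Pair using free le less by (intro regionI) blast+
qed

end

section \<open>Directional derivatives of the energy\<close>

definition energy_deriv ::
    "('n::finite \<times> 'n) set \<Rightarrow> ('n \<Rightarrow> 'n \<Rightarrow> real) \<Rightarrow> 'n set \<Rightarrow> 'n set \<Rightarrow> ('n \<Rightarrow> real) \<Rightarrow> ('n \<Rightarrow> real) \<Rightarrow>
     'n state \<Rightarrow> 'n state \<Rightarrow> real" where
  "energy_deriv E B pv pq P Q = (\<lambda>(\<rho>, \<theta>) (u, v).
     - (\<Sum>i\<in>pv \<union> pq. P i * v $ i) - (\<Sum>i\<in>pq. Q i * u $ i)
     + (\<Sum>(i, j)\<in>E. B i j * (exp (2 * \<rho> $ i) * u $ i + exp (2 * \<rho> $ j) * u $ j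
         - exp (\<rho> $ i + \<rho> $ j) * ((u $ i + u $ j) * cos (\<theta> $ i - \<theta> $ j)
             - (v $ i - v $ j) * sin (\<theta> $ i - \<theta> $ j)))))"

definition energy_deriv2 ::
    "('n::finite \<times> 'n) set \<Rightarrow> ('n \<Rightarrow> 'n \<Rightarrow> real) \<Rightarrow> 'n state \<Rightarrow> 'n state \<Rightarrow> real" where
  "energy_deriv2 E B = (\<lambda>(\<rho>, \<theta>) (u, v).
     \<Sum>(i, j)\<in>E. B i j * (2 * (u $ i)\<^sup>2 * exp (2 * \<rho> $ i) + 2 * (u $ j)\<^sup>2 * exp (2 * \<rho> $ j)
         - exp (\<rho> $ i + \<rho> $ j) * ((u $ i + u $ j)\<^sup>2 * cos (\<theta> $ i - \<theta> $ j)
             - 2 * (u $ i + u $ j) * (v $ i - v $ j) * sin (\<theta> $ i - \<theta> $ j)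
             - (v $ i - v $ j)\<^sup>2 * cos (\<theta> $ i - \<theta> $ j))))"

lemma energy_has_derivative_along_line:
  "((\<lambda>t. energy E B pv pq P Q (x + t *\<^sub>R d)) has_real_derivative
     energy_deriv E B pv pq P Q (x + t *\<^sub>R d) d) (at t)"
proof -
  obtain \<rho> \<theta> u v where xd: "x = (\<rho>, \<theta>)" "d = (u, v)" by (metis surj_pair)
  have edge: "((\<lambda>t. c * ((exp (2 * (a + t * k)) + exp (2 * (b + t * l))) / 2)
        - c * exp ((a + t * k) + (b + t * l)) * cos ((p + t * m) - (q + t * n)))
      has_real_derivative c * (exp (2 * (a + t * k)) * k + exp (2 * (b + t * l)) * l
        - exp ((a + t * k) + (b + t * l)) * ((k + l) * cos ((p + t * m) - (q + t * n))
             - (m - n) * sin ((p + t * m) - (q + t * n))))) (at t)"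
    for a b c k l m n p q :: real
    by (auto intro!: derivative_eq_intros simp: algebra_simps)
  have lin: "((\<lambda>t. a * (b + t * c)) has_real_derivative a * c) (at t)" for a b c :: real
    by (auto intro!: derivative_eq_intros)
  have "((\<lambda>t. - (\<Sum>i\<in>pv \<union> pq. P i * (\<theta> $ i + t * v $ i)) - (\<Sum>i\<in>pq. Q i * (\<rho> $ i + t * u $ i))
      + (\<Sum>e\<in>E. B (fst e) (snd e) * ((exp (2 * (\<rho> $ fst e + t * u $ fst e))
            + exp (2 * (\<rho> $ snd e + t * u $ snd e))) / 2)
          - B (fst e) (snd e) * exp ((\<rho> $ fst e + t * u $ fst e) + (\<rho> $ snd e + t * u $ snd e))
            * cos ((\<theta> $ fst e + t * v $ fst e) - (\<theta> $ snd e + t * v $ snd e))))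
      has_real_derivative energy_deriv E B pv pq P Q (x + t *\<^sub>R d) d) (at t)"
    unfolding energy_deriv_def xd case_prod_unfold fst_add snd_add fst_scaleR snd_scaleR fst_conv snd_conv
      vector_add_component vector_scaleR_component real_scaleR_def
    by (intro DERIV_add DERIV_diff DERIV_minus DERIV_sum edge lin)
  then show ?thesis
    by (simp add: energy_def xd case_prod_unfold sum_subtractf algebra_simps)
qed

lemma energy_deriv_has_derivative_along_line:
  "((\<lambda>t. energy_deriv E B pv pq P Q (x + t *\<^sub>R d) d) has_real_derivative
     energy_deriv2 E B (x + t *\<^sub>R d) d) (at t)"
proof -
  obtain \<rho> \<theta> u v where xd: "x = (\<rho>, \<theta>)" "d = (u, v)" by (metis surj_pair)
  have edge: "((\<lambda>t. c * (exp (2 * (a + t * k)) * k + exp (2 * (b + t * l)) * l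
        - exp ((a + t * k) + (b + t * l)) * ((k + l) * cos ((p + t * m) - (q + t * n))
             - (m - n) * sin ((p + t * m) - (q + t * n)))))
      has_real_derivative c * (2 * k\<^sup>2 * exp (2 * (a + t * k)) + 2 * l\<^sup>2 * exp (2 * (b + t * l))
        - exp ((a + t * k) + (b + t * l)) * ((k + l)\<^sup>2 * cos ((p + t * m) - (q + t * n))
             - 2 * (k + l) * (m - n) * sin ((p + t * m) - (q + t * n))
             - (m - n)\<^sup>2 * cos ((p + t * m) - (q + t * n))))) (at t)"
    for a b c k l m n p q :: real
    by (auto intro!: derivative_eq_intros simp: power2_eq_square) (simp add: algebra_simps)
  have "((\<lambda>t. energy_deriv E B pv pq P Q (x + t *\<^sub>R d) d) has_real_derivative
     0 + energy_deriv2 E B (x + t *\<^sub>R d) d) (at t)"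
    unfolding energy_deriv_def energy_deriv2_def xd case_prod_unfold
      fst_add snd_add fst_scaleR snd_scaleR fst_conv snd_conv
      vector_add_component vector_scaleR_component real_scaleR_def
    by (intro DERIV_add DERIV_const DERIV_sum edge)
  then show ?thesis by simp
qed

context network
begin

lemma free_space_iff:
  "(\<rho>, \<theta>) \<in> free_space pv s \<longleftrightarrow> (\<forall>i. i \<notin> pq \<longrightarrow> \<rho> $ i = 0) \<and> \<theta> $ s = 0"
  unfolding free_space_def using not_in_pq_iff by auto

text \<open>
  Regrouping the sum over edges by vertices exhibits the coefficients of \<open>v\<^sub>i\<close> and \<open>u\<^sub>i\<close> as
  the mismatches in the two families of power flow equations.
\<close>

lemma energy_deriv_eq:
  assumes "(u, v) \<in> free_space pv s"
  shows "energy_deriv E B pv pq P Q (\<rho>, \<theta>) (u, v) =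
    (\<Sum>i\<in>pv \<union> pq. v $ i *
      ((\<Sum>j | adjacent E i j. B i j * exp (\<rho> $ i + \<rho> $ j) * sin (\<theta> $ i - \<theta> $ j)) - P i))
    + (\<Sum>i\<in>pq. u $ i *
      ((\<Sum>j | adjacent E i j. B i j * (exp (2 * \<rho> $ i) - exp (\<rho> $ i + \<rho> $ j) * cos (\<theta> $ i - \<theta> $ j)))
        - Q i))"
proof -
  let ?p = "\<lambda>i j. B i j * exp (\<rho> $ i + \<rho> $ j) * sin (\<theta> $ i - \<theta> $ j)"
  let ?q = "\<lambda>i j. B i j * (exp (2 * \<rho> $ i) - exp (\<rho> $ i + \<rho> $ j) * cos (\<theta> $ i - \<theta> $ j))"
  have p: "(\<Sum>i\<in>pv \<union> pq. v $ i * (\<Sum>j | adjacent E i j. ?p i j))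
      = (\<Sum>i\<in>UNIV. \<Sum>j | adjacent E i j. v $ i * ?p i j)"
    unfolding sum_distrib_left[symmetric]
    using assms by (intro sum.mono_neutral_left) (auto simp: pv_pq_eq free_space_iff)
  have q: "(\<Sum>i\<in>pq. u $ i * (\<Sum>j | adjacent E i j. ?q i j))
      = (\<Sum>i\<in>UNIV. \<Sum>j | adjacent E i j. u $ i * ?q i j)"
    unfolding sum_distrib_left[symmetric]
    using assms by (intro sum.mono_neutral_left) (auto simp: free_space_iff)
  have "(\<Sum>(i, j)\<in>E. B i j * (exp (2 * \<rho> $ i) * u $ i + exp (2 * \<rho> $ j) * u $ j
         - exp (\<rho> $ i + \<rho> $ j) * ((u $ i + u $ j) * cos (\<theta> $ i - \<theta> $ j)
             - (v $ i - v $ j) * sin (\<theta> $ i - \<theta> $ j))))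
      = (\<Sum>(i, j)\<in>E. v $ i * ?p i j + v $ j * ?p j i) + (\<Sum>(i, j)\<in>E. u $ i * ?q i j + u $ j * ?q j i)"
    unfolding sum.distrib[symmetric]
  proof (intro sum.cong refl, clarify)
    fix i j
    have c: "cos (\<theta> $ j - \<theta> $ i) = cos (\<theta> $ i - \<theta> $ j)" by (metis cos_minus minus_diff_eq)
    have s: "sin (\<theta> $ j - \<theta> $ i) = - sin (\<theta> $ i - \<theta> $ j)" by (metis sin_minus minus_diff_eq)
    show "B i j * (exp (2 * \<rho> $ i) * u $ i + exp (2 * \<rho> $ j) * u $ j
         - exp (\<rho> $ i + \<rho> $ j) * ((u $ i + u $ j) * cos (\<theta> $ i - \<theta> $ j)
             - (v $ i - v $ j) * sin (\<theta> $ i - \<theta> $ j)))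
      = v $ i * ?p i j + v $ j * ?p j i + (u $ i * ?q i j + u $ j * ?q j i)"
      unfolding c s B_sym[of j i] add.commute[of "\<rho> $ j" "\<rho> $ i"] by algebra
  qed
  also have "\<dots> = (\<Sum>i\<in>pv \<union> pq. v $ i * (\<Sum>j | adjacent E i j. ?p i j))
      + (\<Sum>i\<in>pq. u $ i * (\<Sum>j | adjacent E i j. ?q i j))"
    unfolding p q sum_adjacent_eq_sum_edges ..
  finally show ?thesis
    unfolding energy_deriv_def case_prod_conv right_diff_distrib sum_subtractf
    by (simp add: mult.commute)
qed

lemma power_flow_iff_critical:
  "power_flow E B pv pq s P Q x \<longleftrightarrow>
     x \<in> free_space pv s \<and> (\<forall>d\<in>free_space pv s. energy_deriv E B pv pq P Q x d = 0)"
proof -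
  obtain \<rho> \<theta> where x: "x = (\<rho>, \<theta>)" by (metis surj_pair)
  let ?p = "\<lambda>i. (\<Sum>j | adjacent E i j. B i j * exp (\<rho> $ i + \<rho> $ j) * sin (\<theta> $ i - \<theta> $ j)) - P i"
  let ?q = "\<lambda>i. (\<Sum>j | adjacent E i j.
      B i j * (exp (2 * \<rho> $ i) - exp (\<rho> $ i + \<rho> $ j) * cos (\<theta> $ i - \<theta> $ j))) - Q i"
  have pf: "power_flow E B pv pq s P Q x \<longleftrightarrow>
      (\<forall>i\<in>pv \<union> pq. ?p i = 0) \<and> (\<forall>i\<in>pq. ?q i = 0) \<and> x \<in> free_space pv s"
    unfolding power_flow_def free_space_def x by (simp add: eq_commute[of "P _"] eq_commute[of "Q _"]) blast
  have crit: "energy_deriv E B pv pq P Q x (u, v)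
      = (\<Sum>i\<in>pv \<union> pq. v $ i * ?p i) + (\<Sum>i\<in>pq. u $ i * ?q i)" if "(u, v) \<in> free_space pv s" for u v
    unfolding x by (rule energy_deriv_eq[OF that])
  show ?thesis
  proof
    assume "power_flow E B pv pq s P Q x"
    then have p: "\<forall>i\<in>pv \<union> pq. ?p i = 0" and q: "\<forall>i\<in>pq. ?q i = 0" and xf: "x \<in> free_space pv s"
      unfolding pf by blast+
    have "energy_deriv E B pv pq P Q x (u, v) = 0" if d: "(u, v) \<in> free_space pv s" for u v
    proof -
      have "(\<Sum>i\<in>pv \<union> pq. v $ i * ?p i) = 0"
        by (intro sum.neutral ballI) (simp only: bspec[OF p] mult_zero_right)
      moreover have "(\<Sum>i\<in>pq. u $ i * ?q i) = 0"
        by (intro sum.neutral ballI) (simp only: bspec[OF q] mult_zero_right)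
      ultimately show ?thesis by (simp only: crit[OF d] add_0)
    qed
    then show "x \<in> free_space pv s \<and> (\<forall>d\<in>free_space pv s. energy_deriv E B pv pq P Q x d = 0)"
      using xf by (metis surj_pair)
  next
    assume *: "x \<in> free_space pv s \<and> (\<forall>d\<in>free_space pv s. energy_deriv E B pv pq P Q x d = 0)"
    \<comment> \<open>Testing with the coordinate directions isolates each single mismatch.\<close>
    have "?p i = 0" if "i \<in> pv \<union> pq" for i
    proof -
      have "i \<noteq> s" using that pv_pq_eq by auto
      then have d: "(0, axis i 1) \<in> free_space pv s" by (simp add: free_space_iff axis_def)
      have "0 = (\<Sum>k\<in>pv \<union> pq. axis i 1 $ k * ?p k)"
        using * d crit[OF d] by simp
      also have "\<dots> = (\<Sum>k\<in>pv \<union> pq. if k = i then ?p k else 0)"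
        by (intro sum.cong refl) (simp add: axis_def)
      also have "\<dots> = ?p i" using that by simp
      finally show ?thesis by simp
    qed
    moreover have "?q i = 0" if "i \<in> pq" for i
    proof -
      have d: "(axis i 1, 0) \<in> free_space pv s" using that by (auto simp: free_space_iff axis_def)
      have "0 = (\<Sum>k\<in>pq. axis i 1 $ k * ?q k)"
        using * d crit[OF d] by simp
      also have "\<dots> = (\<Sum>k\<in>pq. if k = i then ?q k else 0)"
        by (intro sum.cong refl) (simp add: axis_def)
      also have "\<dots> = ?q i" using that by simp
      finally show ?thesis by simp
    qed
    ultimately show "power_flow E B pv pq s P Q x" using * unfolding pf by blast
  qed
qed

text \<open>
  Completing the square in \<open>v\<^sub>i - v\<^sub>j\<close> on each edge. The cosine may vanish on an edge with no
  end in \<open>pq\<close>, but there \<open>u\<close> is zero at both ends and no square has to be completed.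
\<close>

lemma energy_deriv2_eq:
  assumes x: "(\<rho>, \<theta>) \<in> region E B pv pq s" and d: "(u, v) \<in> free_space pv s"
  shows "energy_deriv2 E B (\<rho>, \<theta>) (u, v) = network_form E B \<rho> \<theta> (\<chi> i. exp (\<rho> $ i) * u $ i)
    + (\<Sum>(i, j)\<in>E. B i j * (exp (\<rho> $ i + \<rho> $ j) * cos (\<theta> $ i - \<theta> $ j)
        * (v $ i - v $ j + (u $ i + u $ j) * tan (\<theta> $ i - \<theta> $ j))\<^sup>2))"
  unfolding energy_deriv2_def network_form_def case_prod_conv sum.distrib[symmetric]
proof (intro sum.cong refl, clarify)
  fix i j assume ij: "(i, j) \<in> E"
  define a where "a = exp (\<rho> $ i)"
  define b where "b = exp (\<rho> $ j)"
  have ab: "a > 0" "b > 0" by (auto simp: a_def b_def)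
  have e: "exp (2 * \<rho> $ i) = a\<^sup>2" "exp (2 * \<rho> $ j) = b\<^sup>2" "exp (\<rho> $ i + \<rho> $ j) = a * b"
    "exp (\<rho> $ j - \<rho> $ i) = b / a" "exp (\<rho> $ i - \<rho> $ j) = a / b"
    by (auto simp: a_def b_def exp_add exp_diff exp_double)
  let ?c = "cos (\<theta> $ i - \<theta> $ j)" and ?s = "sin (\<theta> $ i - \<theta> $ j)"
  let ?k = "u $ i + u $ j" and ?w = "v $ i - v $ j"
  have f: "edge_form \<rho> \<theta> (\<chi> i. exp (\<rho> $ i) * u $ i) i j
      = 2 * a\<^sup>2 * (u $ i)\<^sup>2 + 2 * b\<^sup>2 * (u $ j)\<^sup>2 - a * b * ?k\<^sup>2 / ?c"
  proof -
    have "b / a * (a * u $ i)\<^sup>2 + 2 * (a * u $ i) * (b * u $ j) + a / b * (b * u $ j)\<^sup>2 = a * b * ?k\<^sup>2"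
      using ab by (simp add: power2_eq_square field_simps)
    then show ?thesis
      unfolding edge_form_def e by (simp add: a_def[symmetric] b_def[symmetric] power_mult_distrib)
  qed
  have "2 * (u $ i)\<^sup>2 * a\<^sup>2 + 2 * (u $ j)\<^sup>2 * b\<^sup>2 - a * b * (?k\<^sup>2 * ?c - 2 * ?k * ?w * ?s - ?w\<^sup>2 * ?c)
      = edge_form \<rho> \<theta> (\<chi> i. exp (\<rho> $ i) * u $ i) i j + a * b * ?c * (?w + ?k * tan (\<theta> $ i - \<theta> $ j))\<^sup>2"
  proof (cases "i \<in> pq \<or> j \<in> pq")
    case True
    then have c: "0 < ?c" using region_cos_nonneg(2)[OF x ij] by blast
    have "?k\<^sup>2 / ?c - ?k\<^sup>2 * ?c = ?k\<^sup>2 * (1 - ?c\<^sup>2) / ?c"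
      using c by (simp add: field_simps power2_eq_square)
    also have "1 - ?c\<^sup>2 = ?s\<^sup>2" using sin_squared_eq[of "\<theta> $ i - \<theta> $ j"] by simp
    \<comment> \<open>Since \<open>-cos = -1/cos + sin\<^sup>2/cos\<close>, the matrix form and the completed square share the term in \<open>u\<close>.\<close>
    finally have 1: "- ?k\<^sup>2 * ?c = - ?k\<^sup>2 / ?c + ?k\<^sup>2 * ?s\<^sup>2 / ?c" by simp
    have 2: "?c * (?w + ?k * tan (\<theta> $ i - \<theta> $ j))\<^sup>2 = ?w\<^sup>2 * ?c + 2 * ?k * ?w * ?s + ?k\<^sup>2 * ?s\<^sup>2 / ?c"
      using c by (simp add: tan_def field_simps power2_eq_square)
    have "- (?k\<^sup>2 * ?c - 2 * ?k * ?w * ?s - ?w\<^sup>2 * ?c)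
        = - ?k\<^sup>2 / ?c + ?c * (?w + ?k * tan (\<theta> $ i - \<theta> $ j))\<^sup>2"
      unfolding 2 using 1 by simp
    then have "a * b * - (?k\<^sup>2 * ?c - 2 * ?k * ?w * ?s - ?w\<^sup>2 * ?c)
        = a * b * (- ?k\<^sup>2 / ?c + ?c * (?w + ?k * tan (\<theta> $ i - \<theta> $ j))\<^sup>2)"
      by (rule arg_cong)
    then show ?thesis unfolding f by (simp add: algebra_simps)
  next
    case False
    then have "u $ i = 0" "u $ j = 0" using d by (auto simp: free_space_iff)
    then show ?thesis unfolding f by simp
  qed
  then show "B i j * (2 * (u $ i)\<^sup>2 * exp (2 * \<rho> $ i) + 2 * (u $ j)\<^sup>2 * exp (2 * \<rho> $ j)
         - exp (\<rho> $ i + \<rho> $ j) * (?k\<^sup>2 * ?c - 2 * ?k * ?w * ?s - ?w\<^sup>2 * ?c))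
      = B i j * edge_form \<rho> \<theta> (\<chi> i. exp (\<rho> $ i) * u $ i) i j
        + B i j * (exp (\<rho> $ i + \<rho> $ j) * ?c * (?w + ?k * tan (\<theta> $ i - \<theta> $ j))\<^sup>2)"
    unfolding e by (simp only: distrib_left[symmetric])
qed

lemma energy_deriv2_nonneg:
  assumes x: "x \<in> region E B pv pq s" and d: "d \<in> free_space pv s"
  shows "0 \<le> energy_deriv2 E B x d"
proof -
  obtain \<rho> \<theta> u v where xd: "x = (\<rho>, \<theta>)" "d = (u, v)" by (metis surj_pair)
  have "0 \<le> network_form E B \<rho> \<theta> (\<chi> i. exp (\<rho> $ i) * u $ i)"
    using d by (intro regionD(4)[OF x[unfolded xd]]) (simp add: xd free_space_iff)
  moreover have "0 \<le> (\<Sum>(i, j)\<in>E. B i j * (exp (\<rho> $ i + \<rho> $ j) * cos (\<theta> $ i - \<theta> $ j)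
        * (v $ i - v $ j + (u $ i + u $ j) * tan (\<theta> $ i - \<theta> $ j))\<^sup>2))"
  proof (rule sum_nonneg, clarify)
    fix i j assume ij: "(i, j) \<in> E"
    show "0 \<le> B i j * (exp (\<rho> $ i + \<rho> $ j) * cos (\<theta> $ i - \<theta> $ j)
        * (v $ i - v $ j + (u $ i + u $ j) * tan (\<theta> $ i - \<theta> $ j))\<^sup>2)"
      using B_pos[OF ij] region_cos_nonneg(1)[OF x[unfolded xd] ij] by simp
  qed
  ultimately show ?thesis
    unfolding xd energy_deriv2_eq[OF x[unfolded xd] d[unfolded xd]] by simp
qed

section \<open>Critical points and minimizers\<close>

lemma optimal_iff:
  "optimal E B pv pq s P Q x \<longleftrightarrow> x \<in> region E B pv pq s
    \<and> (\<forall>y\<in>region E B pv pq s. energy E B pv pq P Q x \<le> energy E B pv pq P Q y)"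
proof -
  have "(\<lambda>(\<rho>, \<theta>). (\<rho>, \<theta>) \<in> region E B pv pq s \<and> \<theta> $ s = 0 \<and> \<rho> $ s = 0)
      = (\<lambda>x. x \<in> region E B pv pq s)"
    by (auto simp: region_def free_space_def)
  then show ?thesis
    by (auto simp: optimal_def is_arg_min_linorder)
qed

lemma region_in_free_space: "x \<in> region E B pv pq s \<Longrightarrow> x \<in> free_space pv s"
  by (cases x) (simp add: regionD(1))

text \<open>
  The segment from \<open>x\<close> to \<open>y\<close> stays in the region, where the second derivative is nonnegative.
\<close>

lemma critical_point_minimum:
  assumes x: "x \<in> region E B pv pq s" and y: "y \<in> region E B pv pq s"
    and crit: "\<And>d. d \<in> free_space pv s \<Longrightarrow> energy_deriv E B pv pq P Q x d = 0"
  shows "energy E B pv pq P Q x \<le> energy E B pv pq P Q y"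
    and "energy E B pv pq P Q y \<le> energy E B pv pq P Q x \<Longrightarrow> energy_deriv2 E B x (y - x) = 0"
proof -
  have d: "y - x \<in> free_space pv s"
    using x y by (intro subspace_diff subspace_free_space region_in_free_space)
  have "0 \<le> energy_deriv2 E B (x + t *\<^sub>R (y - x)) (y - x)" if "0 \<le> t" "t \<le> 1" for t
  proof (rule energy_deriv2_nonneg[OF _ d])
    show "x + t *\<^sub>R (y - x) \<in> region E B pv pq s"
      using convexD_alt[OF convex_region x y that] by (simp add: algebra_simps)
  qed
  note min = convex_critical_point_minimum[where f = "\<lambda>t. energy E B pv pq P Q (x + t *\<^sub>R (y - x))"
      and f' = "\<lambda>t. energy_deriv E B pv pq P Q (x + t *\<^sub>R (y - x)) (y - x)",
      OF energy_has_derivative_along_line energy_deriv_has_derivative_along_line this]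
  show "energy E B pv pq P Q x \<le> energy E B pv pq P Q y"
    using min(1) crit[OF d] by simp
  show "energy_deriv2 E B x (y - x) = 0" if "energy E B pv pq P Q y \<le> energy E B pv pq P Q x"
    using min(2) crit[OF d] that by simp
qed

lemma interior_region_line:
  assumes x: "x \<in> top_of_set (free_space pv s) interior_of region E B pv pq s"
    and d: "d \<in> free_space pv s"
  obtains e where "0 < e" "\<And>t. \<bar>t\<bar> < e \<Longrightarrow> x + t *\<^sub>R d \<in> region E B pv pq s"
proof -
  obtain T where T: "openin (top_of_set (free_space pv s)) T" "x \<in> T" "T \<subseteq> region E B pv pq s"
    using x unfolding interior_of_def by blast
  then obtain r where r: "0 < r" "ball x r \<inter> free_space pv s \<subseteq> T"
    unfolding openin_contains_ball by blast
  have xf: "x \<in> free_space pv s" using T openin_imp_subset by blast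
  show thesis
  proof
    have pos: "0 < norm d + 1" by (simp add: add_nonneg_pos)
    then show "0 < r / (norm d + 1)" using r(1) by simp
    fix t :: real assume "\<bar>t\<bar> < r / (norm d + 1)"
    then have "\<bar>t\<bar> * (norm d + 1) < r" by (simp only: pos_less_divide_eq[OF pos])
    then have "norm (t *\<^sub>R d) < r" by (simp add: algebra_simps)
    then have "x + t *\<^sub>R d \<in> ball x r" by (simp add: dist_norm)
    moreover have "x + t *\<^sub>R d \<in> free_space pv s"
      by (intro subspace_add subspace_scale subspace_free_space xf d)
    ultimately show "x + t *\<^sub>R d \<in> region E B pv pq s" using r(2) T(3) by blast
  qed
qed

lemma interior_of_region_subset:
  "top_of_set (free_space pv s) interior_of region E B pv pq s \<subseteq> region E B pv pq s"
  by (rule interior_of_subset)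

lemma interior_minimizer_critical:
  assumes x: "x \<in> top_of_set (free_space pv s) interior_of region E B pv pq s"
    and opt: "optimal E B pv pq s P Q x" and d: "d \<in> free_space pv s"
  shows "energy_deriv E B pv pq P Q x d = 0"
proof -
  obtain e where e: "0 < e" "\<And>t. \<bar>t\<bar> < e \<Longrightarrow> x + t *\<^sub>R d \<in> region E B pv pq s"
    using interior_region_line[OF x d] by blast
  have der: "((\<lambda>t. energy E B pv pq P Q (x + t *\<^sub>R d)) has_real_derivative
      energy_deriv E B pv pq P Q x d) (at 0)"
    using energy_has_derivative_along_line[of E B pv pq P Q x d 0] by simp
  show ?thesis
    by (rule DERIV_local_min[OF der e(1)]) (use opt e(2) in \<open>auto simp: optimal_iff\<close>)
qed

lemma power_flow_iff_optimal:
  assumes x: "x \<in> top_of_set (free_space pv s) interior_of region E B pv pq s"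
  shows "power_flow E B pv pq s P Q x \<longleftrightarrow> optimal E B pv pq s P Q x"
proof
  have xR: "x \<in> region E B pv pq s" using x interior_of_region_subset by blast
  show "optimal E B pv pq s P Q x" if "power_flow E B pv pq s P Q x"
    using that xR critical_point_minimum(1)[OF xR]
    unfolding optimal_iff power_flow_iff_critical by blast
  show "power_flow E B pv pq s P Q x" if "optimal E B pv pq s P Q x"
    unfolding power_flow_iff_critical
    using interior_minimizer_critical[OF x that] region_in_free_space[OF xR] by blast
qed

section \<open>Uniqueness on a connected network\<close>

text \<open>
  The phase of every vertex other than the slack bus is a free variable, so it can be moved in both directions
  inside the region. The bound \<open>\<delta> < pi\<close> keeps \<open>cos \<delta>\<close> away from the value \<open>1\<close> at the next period.
\<close>

lemma interior_phase_shift: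
  assumes x: "(\<rho>, \<theta>) \<in> top_of_set (free_space pv s) interior_of region E B pv pq s" and "k \<noteq> s"
  obtains \<delta> where "0 < \<delta>" "\<delta> < pi"
    "(\<rho>, \<theta> + axis k \<delta>) \<in> region E B pv pq s" "(\<rho>, \<theta> - axis k \<delta>) \<in> region E B pv pq s"
proof -
  have "(0, axis k 1) \<in> free_space pv s" using \<open>k \<noteq> s\<close> by (simp add: free_space_iff axis_def)
  from interior_region_line[OF x this] obtain e where
    e: "0 < e" "\<And>t. \<bar>t\<bar> < e \<Longrightarrow> (\<rho>, \<theta>) + t *\<^sub>R (0, axis k 1) \<in> region E B pv pq s" by blast
  define \<delta> where "\<delta> = min (e / 2) 1"
  have \<delta>: "0 < \<delta>" "\<delta> < e" "\<delta> < pi" using e(1) pi_gt3 by (auto simp: \<delta>_def)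
  have ax: "\<delta> *\<^sub>R axis k 1 = (axis k \<delta> :: real ^ 'n)" by (simp add: vec_eq_iff axis_def)
  show thesis
    using that[OF \<delta>(1,3)] e(2)[of \<delta>] e(2)[of "- \<delta>"] \<delta> by (simp add: ax)
qed

text \<open>
  On edges without an end in \<open>pq\<close> the region allows phase differences of exactly \<open>\<plusminus>pi / 2\<close>;
  interior points avoid them because one end of the edge has a free phase.
\<close>

lemma interior_region_cos_pos:
  assumes x: "(\<rho>, \<theta>) \<in> top_of_set (free_space pv s) interior_of region E B pv pq s" and ij: "(i, j) \<in> E"
  shows "0 < cos (\<theta> $ i - \<theta> $ j)"
proof -
  have ne: "i \<noteq> j" using edge_neq[OF ij] .
  define k where "k = (if i = s then j else i)"
  have "k \<noteq> s" using ne by (auto simp: k_def)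
  from interior_phase_shift[OF x this] obtain \<delta> where \<delta>: "0 < \<delta>"
    "(\<rho>, \<theta> + axis k \<delta>) \<in> region E B pv pq s" "(\<rho>, \<theta> - axis k \<delta>) \<in> region E B pv pq s" by metis
  have "\<bar>\<theta> $ i - \<theta> $ j + \<delta>\<bar> \<le> pi / 2" "\<bar>\<theta> $ i - \<theta> $ j - \<delta>\<bar> \<le> pi / 2"
    using regionD(2)[OF \<delta>(2) ij] regionD(2)[OF \<delta>(3) ij] ne
    by (auto simp: k_def axis_def algebra_simps split: if_splits)
  then show ?thesis using \<delta>(1) by (intro cos_gt_zero_pi) linarith+
qed

lemma connected_network_neighbour:
  assumes "connected_network E" "i \<noteq> j"
  obtains k where "(i, k) \<in> E \<or> (k, i) \<in> E"
proof -
  have "(i, j) \<in> (E \<union> E\<inverse>)\<^sup>*" using assms(1) by (simp add: connected_network_def)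
  then show thesis using assms(2) that by (cases rule: converse_rtranclE) auto
qed

text \<open>
  Shifting the phase of one end of an edge changes the phase difference by \<open>\<plusminus>\<delta>\<close>, so that strict convexity
  of \<open>1 / cos\<close> applies as soon as its coefficient is positive.
\<close>

lemma edge_form_phase_shift:
  assumes ij: "(i, j) \<in> E" "k \<in> {i, j}" and z: "\<And>i. 0 \<le> z $ i" "z $ k \<noteq> 0"
    and c: "0 < cos (\<theta> $ i - \<theta> $ j)" "0 < cos ((\<theta> + axis k \<delta>) $ i - (\<theta> + axis k \<delta>) $ j)"
      "0 < cos ((\<theta> - axis k \<delta>) $ i - (\<theta> - axis k \<delta>) $ j)"
    and \<delta>: "0 < \<delta>" "\<delta> < pi"
  shows "edge_form \<rho> (\<theta> + axis k \<delta>) z i j + edge_form \<rho> (\<theta> - axis k \<delta>) z i j < 2 * edge_form \<rho> \<theta> z i j"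
proof -
  define N where "N = exp (\<rho> $ j - \<rho> $ i) * (z $ i)\<^sup>2 + 2 * (z $ i) * (z $ j) + exp (\<rho> $ i - \<rho> $ j) * (z $ j)\<^sup>2"
  let ?a = "\<theta> $ i - \<theta> $ j"
  let ?p = "(\<theta> + axis k \<delta>) $ i - (\<theta> + axis k \<delta>) $ j" and ?m = "(\<theta> - axis k \<delta>) $ i - (\<theta> - axis k \<delta>) $ j"
  have ne: "i \<noteq> j" using edge_neq[OF ij(1)] .
  have nn: "0 \<le> exp (\<rho> $ j - \<rho> $ i) * (z $ i)\<^sup>2" "0 \<le> 2 * (z $ i) * (z $ j)"
    "0 \<le> exp (\<rho> $ i - \<rho> $ j) * (z $ j)\<^sup>2"
    using z(1) by simp_all
  have "0 < exp (\<rho> $ j - \<rho> $ i) * (z $ i)\<^sup>2 \<or> 0 < exp (\<rho> $ i - \<rho> $ j) * (z $ j)\<^sup>2"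
    using ij(2) z(2) by auto
  then have N: "0 < N" using nn unfolding N_def by linarith
  have form: "edge_form \<rho> \<theta>' z i j = 2 * (z $ i)\<^sup>2 + 2 * (z $ j)\<^sup>2 - N * (1 / cos (\<theta>' $ i - \<theta>' $ j))" for \<theta>'
    by (simp add: edge_form_def N_def)
  have "(?p = ?a + \<delta> \<and> ?m = ?a - \<delta>) \<or> (?p = ?a - \<delta> \<and> ?m = ?a + \<delta>)"
    using ij(2) ne by (auto simp: axis_def)
  then have "2 / cos ?a < 1 / cos ?p + 1 / cos ?m"
    using inverse_cos_strict_midpoint[of ?a \<delta>] c \<delta> by (elim disjE conjE) (simp_all only: add.commute)
  from mult_strict_left_mono[OF this N]
  have "2 * (N * (1 / cos ?a)) < N * (1 / cos ?p) + N * (1 / cos ?m)"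
    by (simp only: distrib_left times_divide_eq_right mult_1_right mult.commute)
  moreover have "a - b + (a - c) < 2 * (a - d)" if "2 * d < b + c" for a b c d :: real
    using that by simp
  ultimately show ?thesis unfolding form by blast
qed

text \<open>
  If \<open>z\<^sub>k \<noteq> 0\<close>, moving the phase of \<open>k\<close> by \<open>\<plusminus>\<delta>\<close> would make the form at \<open>\<bar>z\<bar>\<close> negative on average,
  although both shifted states lie in the region.
\<close>

lemma interior_network_form_definite:
  assumes conn: "connected_network E"
    and x: "(\<rho>, \<theta>) \<in> top_of_set (free_space pv s) interior_of region E B pv pq s"
    and z: "\<And>i. i \<notin> pq \<Longrightarrow> z $ i = 0" and le: "network_form E B \<rho> \<theta> z \<le> 0"
  shows "z = 0"
proof (rule ccontr)
  assume "z \<noteq> 0"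
  then obtain k where k: "z $ k \<noteq> 0" by (auto simp: vec_eq_iff)
  then have kpq: "k \<in> pq" using z by blast
  then have "k \<noteq> s" using not_in_pq_iff by auto
  obtain l where l: "(k, l) \<in> E \<or> (l, k) \<in> E"
    using connected_network_neighbour[OF conn \<open>k \<noteq> s\<close>] by blast
  obtain \<delta> where \<delta>: "0 < \<delta>" "\<delta> < pi"
    and p: "(\<rho>, \<theta> + axis k \<delta>) \<in> region E B pv pq s" and m: "(\<rho>, \<theta> - axis k \<delta>) \<in> region E B pv pq s"
    using interior_phase_shift[OF x \<open>k \<noteq> s\<close>] by metis
  have xR: "(\<rho>, \<theta>) \<in> region E B pv pq s" using x interior_of_region_subset by blast
  define w where "w = (\<chi> i. \<bar>z $ i\<bar>)"
  have w: "\<And>i. 0 \<le> w $ i" "w $ k \<noteq> 0" "\<And>i. i \<notin> pq \<Longrightarrow> w $ i = 0"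
    using k z by (auto simp: w_def)
  let ?f = "\<lambda>i j. edge_form \<rho> (\<theta> + axis k \<delta>) w i j + edge_form \<rho> (\<theta> - axis k \<delta>) w i j"
  have strict: "?f i j < 2 * edge_form \<rho> \<theta> w i j" if "(i, j) \<in> E" "k \<in> {i, j}" for i j
  proof (rule edge_form_phase_shift[OF that w(1,2) _ _ _ \<delta>])
    have "i \<in> pq \<or> j \<in> pq" using that(2) kpq by blast
    then show "0 < cos (\<theta> $ i - \<theta> $ j)" "0 < cos ((\<theta> + axis k \<delta>) $ i - (\<theta> + axis k \<delta>) $ j)"
      "0 < cos ((\<theta> - axis k \<delta>) $ i - (\<theta> - axis k \<delta>) $ j)"
      using region_cos_nonneg(2)[OF xR that(1)] region_cos_nonneg(2)[OF p that(1)]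
        region_cos_nonneg(2)[OF m that(1)] by blast+
  qed
  have weak: "?f i j = 2 * edge_form \<rho> \<theta> w i j" if "k \<notin> {i, j}" for i j
  proof -
    have "axis k \<delta> $ i = 0" "axis k \<delta> $ j = 0" using that by (auto simp: axis_def)
    then have "edge_form \<rho> (\<theta> + axis k \<delta>) w i j = edge_form \<rho> \<theta> w i j"
      "edge_form \<rho> (\<theta> - axis k \<delta>) w i j = edge_form \<rho> \<theta> w i j"
      by (simp_all add: edge_form_def)
    then show ?thesis by simp
  qed
  have "(\<Sum>(i, j)\<in>E. B i j * ?f i j) < (\<Sum>(i, j)\<in>E. B i j * (2 * edge_form \<rho> \<theta> w i j))"
  proof (rule sum_strict_mono_ex1)
    show "\<forall>e\<in>E. (case e of (i, j) \<Rightarrow> B i j * ?f i j) \<le> (case e of (i, j) \<Rightarrow> B i j * (2 * edge_form \<rho> \<theta> w i j))"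
    proof clarify
      fix i j assume ij: "(i, j) \<in> E"
      have "?f i j \<le> 2 * edge_form \<rho> \<theta> w i j"
        using strict[OF ij] weak[of i j] by (cases "k \<in> {i, j}") auto
      then show "B i j * ?f i j \<le> B i j * (2 * edge_form \<rho> \<theta> w i j)"
        using B_pos[OF ij] by (intro mult_left_mono) auto
    qed
    obtain i j where ij: "(i, j) \<in> E" "k \<in> {i, j}" using l by blast
    show "\<exists>e\<in>E. (case e of (i, j) \<Rightarrow> B i j * ?f i j) < (case e of (i, j) \<Rightarrow> B i j * (2 * edge_form \<rho> \<theta> w i j))"
      using mult_strict_left_mono[OF strict[OF ij] B_pos[OF ij(1)]] ij(1) by (intro bexI[of _ "(i, j)"]) simp_all
  qed simp
  then have "network_form E B \<rho> (\<theta> + axis k \<delta>) w + network_form E B \<rho> (\<theta> - axis k \<delta>) w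
      < 2 * network_form E B \<rho> \<theta> w"
    by (simp add: network_form_def case_prod_unfold sum.distrib[symmetric] sum_distrib_left algebra_simps)
  moreover have "network_form E B \<rho> \<theta> w \<le> 0"
    using network_form_abs_le[of \<theta> \<rho> z] region_cos_nonneg(1)[OF xR] le unfolding w_def by fastforce
  ultimately show False
    using regionD(4)[OF p, of w] regionD(4)[OF m, of w] w(3) by fastforce
qed

text \<open>
  Both summands of \<open>energy_deriv2_eq\<close> vanish: the first gives \<open>u = 0\<close>, and then the second gives
  \<open>v\<^sub>i = v\<^sub>j\<close> on every edge, which propagates from \<open>v\<^sub>s = 0\<close> through the network.
\<close>

lemma interior_energy_deriv2_definite:
  assumes conn: "connected_network E"
    and x: "x \<in> top_of_set (free_space pv s) interior_of region E B pv pq s"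
    and d: "d \<in> free_space pv s" and zero: "energy_deriv2 E B x d = 0"
  shows "d = 0"
proof -
  obtain \<rho> \<theta> u v where xd: "x = (\<rho>, \<theta>)" "d = (u, v)" by (metis surj_pair)
  note x = x[unfolded xd] and d = d[unfolded xd]
  have xR: "(\<rho>, \<theta>) \<in> region E B pv pq s" using x interior_of_region_subset by blast
  define z where "z = (\<chi> i. exp (\<rho> $ i) * u $ i)"
  let ?sq = "\<lambda>i j. B i j * (exp (\<rho> $ i + \<rho> $ j) * cos (\<theta> $ i - \<theta> $ j)
        * (v $ i - v $ j + (u $ i + u $ j) * tan (\<theta> $ i - \<theta> $ j))\<^sup>2)"
  have supp: "z $ i = 0" if "i \<notin> pq" for i
    using d that by (simp add: z_def free_space_iff)
  have sq: "0 \<le> ?sq i j" if "(i, j) \<in> E" for i j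
    using B_pos[OF that] region_cos_nonneg(1)[OF xR that] by simp
  then have sq': "\<And>e. e \<in> E \<Longrightarrow> 0 \<le> (case e of (i, j) \<Rightarrow> ?sq i j)" by auto
  have "network_form E B \<rho> \<theta> z + (\<Sum>(i, j)\<in>E. ?sq i j) = 0"
    using zero energy_deriv2_eq[OF xR d] by (simp add: xd z_def)
  moreover have "0 \<le> network_form E B \<rho> \<theta> z" by (rule regionD(4)[OF xR supp])
  moreover have "0 \<le> (\<Sum>(i, j)\<in>E. ?sq i j)" by (rule sum_nonneg[OF sq'])
  ultimately have "network_form E B \<rho> \<theta> z \<le> 0" and sum0: "(\<Sum>(i, j)\<in>E. ?sq i j) = 0" by linarith+
  then have "z = 0" using interior_network_form_definite[OF conn x supp] by blast
  then have u: "u = 0" by (simp add: z_def vec_eq_iff)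
  have edge: "v $ i = v $ j" if "(i, j) \<in> E" for i j
  proof -
    have "?sq i j = 0" using sum_nonneg_0[OF finite sq' sum0 that] by simp
    then show ?thesis
      using B_pos[OF that] interior_region_cos_pos[OF x that] by (simp add: u)
  qed
  have "v $ i = 0" for i
  proof -
    have "(s, i) \<in> (E \<union> E\<inverse>)\<^sup>*" using conn by (simp add: connected_network_def)
    then have "v $ i = v $ s"
    proof (induction rule: rtrancl_induct)
      case (step j k)
      then show ?case using edge[of j k] edge[of k j] by auto
    qed simp
    then show ?thesis using d by (simp add: free_space_iff)
  qed
  then show ?thesis using u by (simp add: xd vec_eq_iff zero_prod_def)
qed

lemma interior_optimal_unique:
  assumes conn: "connected_network E"
    and x: "x \<in> top_of_set (free_space pv s) interior_of region E B pv pq s"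
    and opt: "optimal E B pv pq s P Q x" and opt': "optimal E B pv pq s P Q y"
  shows "y = x"
proof -
  have xR: "x \<in> region E B pv pq s" and yR: "y \<in> region E B pv pq s"
    using opt opt' by (auto simp: optimal_iff)
  have "energy E B pv pq P Q y \<le> energy E B pv pq P Q x"
    using opt' xR by (simp add: optimal_iff)
  from critical_point_minimum(2)[OF xR yR interior_minimizer_critical[OF x opt] this]
  have "energy_deriv2 E B x (y - x) = 0" .
  moreover have "y - x \<in> free_space pv s"
    by (intro subspace_diff subspace_free_space region_in_free_space xR yR)
  ultimately have "y - x = 0"
    by (intro interior_energy_deriv2_definite[OF conn x])
  then show ?thesis by simp
qed

end

theorem corollary1:
  fixes E :: "('n::finite \<times> 'n) set"
    and B :: "'n \<Rightarrow> 'n \<Rightarrow> real"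
    and pv pq :: "'n set"
    and s :: 'n
    and P Q :: "'n \<Rightarrow> real"
    and S :: "((real ^ 'n) \<times> (real ^ 'n)) set"
  assumes "power_network E B pv pq s"
    and "S \<subseteq> top_of_set (free_space pv s) interior_of region E B pv pq s"
  shows "((\<exists>x\<in>S. power_flow E B pv pq s P Q x) \<longleftrightarrow> (\<exists>x\<in>S. optimal E B pv pq s P Q x)) \<and>
    (connected_network E \<longrightarrow>
      ((\<exists>x\<in>S. power_flow E B pv pq s P Q x) \<longleftrightarrow>
       (\<exists>x\<in>S. {y. optimal E B pv pq s P Q y} = {x})))"
proof -
  interpret network E B pv pq s by standard (rule assms(1))
  have "x \<in> top_of_set (free_space pv s) interior_of region E B pv pq s" if "x \<in> S" for x
    using that assms(2) by blast
  then have iff: "power_flow E B pv pq s P Q x \<longleftrightarrow> optimal E B pv pq s P Q x"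
    and unique: "connected_network E \<Longrightarrow>
      optimal E B pv pq s P Q x \<longleftrightarrow> {y. optimal E B pv pq s P Q y} = {x}" if "x \<in> S" for x
    using that power_flow_iff_optimal interior_optimal_unique by blast+
  then show ?thesis by (metis (no_types, lifting))
qed

end
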